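(* Let $u=u_k\in H$ ($k\le k_{\max}$) be an eigenvector corresponding to the eigenvalue $\lambda=\lambda_k$, let $\Lambda$ be a neighborhood of $\lambda$, and $u^e=\mathcal E u$. Then $$\|u^e-Q_h^\Lambda u^e\|_h\le\max\{1,\gamma_\Lambda\}\,\|u^e-P_hu^e\|_h+\gamma_\Lambda\,\tilde\lambda_1^{-1/2}\,\|d_\lambda(u^e,\cdot)\|_{V_h'} .$$
   Context: Setting. $H\subset\hat H$ are infinite-dimensional real Hilbert spaces, $H$ compactly embedded in $\hat H$; $a:H\times H\to\mathbb R$ is a bounded symmetric elliptic bilinear form; $b(\cdot,\cdot)$ is the scalar product of $\hat H$. Let $0<\lambda_1\le\lambda_2\le\dots$ be the eigenvalues (with multiplicity, tending to infinity) and $u_1,u_2,\ldots\in H$ corresponding eigenvectors of $a(u,v)=\lambda b(u,v)$ for all $v\in H$, with $a(u_k,u_\ell)=\lambda_k\delta_{k\ell}$, $b(u_k,u_\ell)=\delta_{k\ell}$. Fix $k_{\max}\in\mathbb N$. $H^{\rm ex}$ is a further real vector space and $\mathcal E:H\to H^{\rm ex}$ is a linear injective extension operator. $V_h\subset H^{\rm ex}$ is a finite-dimensional subspace, $n:=\dim V_h$. $a_h(\cdot,\cdot)$, $b_h(\cdot,\cdot)$ are symmetric positive semidefinite bilinear forms on $H^{\rm ex}$ that are positive definite on $V_h$; $|||u|||_h:=a_h(u,u)^{1/2}$, $\|u\|_h:=b_h(u,u)^{1/2}$. Discrete eigenproblem: $\tilde u_1,\dots,\tilde u_n\in V_h$ is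 a basis of $V_h$ and $0<\tilde\lambda_1\le\dots\le\tilde\lambda_n$ are such that $a_h(\tilde u_k,\tilde u_\ell)=\tilde\lambda_k\delta_{k\ell}$, $b_h(\tilde u_k,\tilde u_\ell)=\delta_{k\ell}$. $P_h:H^{\rm ex}\to V_h$ is the $a_h$-orthogonal projection: $a_h(P_hw,v_h)=a_h(w,v_h)$ for all $v_h\in V_h$. For a neighborhood $\Lambda$ of $\lambda$ (so $\lambda\in\Lambda$) define $$Q_h^\Lambda w:=\sum_{\tilde\lambda_i\in\Lambda}b_h(w,\tilde u_i)\tilde u_i\quad(w\in H^{\rm ex}),\qquad\gamma_\Lambda:=\max_{\tilde\lambda_i\notin\Lambda}\frac{\tilde\lambda_i}{|\tilde\lambda_i-\lambda|}.$$ The defect is $d_\lambda(w,v):=a_h(w,v)-\lambda b_h(w,v)$, $w,v\in H^{\rm ex}$, and for $L\in V_h'$, $\|L\|_{V_h'}:=\max_{0\ne v_h\in V_h}L(v_h)/|||v_h|||_h$. *)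

theory Defs
  imports "HOL-Analysis.Analysis"
begin

definition finite_dim :: "'a::real_vector set \<Rightarrow> bool" where
  "finite_dim S \<longleftrightarrow> (\<exists>B. finite B \<and> S \<subseteq> span B)"

definition symmetric_form :: "('a \<Rightarrow> 'a \<Rightarrow> real) \<Rightarrow> bool" where
  "symmetric_form a \<longleftrightarrow> (\<forall>v w. a v w = a w v)"

definition elliptic_form :: "('h::real_normed_vector \<Rightarrow> 'h \<Rightarrow> real) \<Rightarrow> bool" where
  "elliptic_form a \<longleftrightarrow> (\<exists>\<alpha>>0. \<forall>v. \<alpha> * (norm v)\<^sup>2 \<le> a v v)"

(* An inclusion of Hilbert spaces with different norms is rendered as an injective linear map
   between two types; it is a compact embedding if bounded sets become relatively compact
   (which entails continuity of the map). *)
definition compact_embedding ::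
    "('h::real_normed_vector \<Rightarrow> 'g::real_normed_vector) \<Rightarrow> bool" where
  "compact_embedding j \<longleftrightarrow>
     linear j \<and> inj j \<and> (\<forall>S. bounded S \<longrightarrow> compact (closure (j ` S)))"

definition eigenspace ::
    "('h::real_vector \<Rightarrow> 'h \<Rightarrow> real) \<Rightarrow> ('h \<Rightarrow> 'h \<Rightarrow> real) \<Rightarrow> real \<Rightarrow> 'h set" where
  "eigenspace a b \<mu> = {v. \<forall>w. a v w = \<mu> * b v w}"

(* Sequences are indexed from 1; their values at 0 are irrelevant.  The last condition says that
   the list is complete and counts multiplicities: every eigenspace is spanned by the (b-orthonormal)
   u k belonging to it, and in particular is {0} for a number not in the list. *)
definition eigensystem ::
    "('h::real_vector \<Rightarrow> 'h \<Rightarrow> real) \<Rightarrow> ('h \<Rightarrow> 'h \<Rightarrow> real) \<Rightarrow> (nat \<Rightarrow> real) \<Rightarrow> (nat \<Rightarrow> 'h) \<Rightarrow> bool" where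
  "eigensystem a b lam u \<longleftrightarrow>
     0 < lam 1 \<and> mono_on {1..} lam \<and> filterlim lam at_top sequentially \<and>
     (\<forall>k\<ge>1. u k \<in> eigenspace a b (lam k)) \<and>
     (\<forall>k\<ge>1. \<forall>l\<ge>1. a (u k) (u l) = (if k = l then lam k else 0)) \<and>
     (\<forall>k\<ge>1. \<forall>l\<ge>1. b (u k) (u l) = (if k = l then 1 else 0)) \<and>
     (\<forall>\<mu>. eigenspace a b \<mu> = span (u ` {k. 1 \<le> k \<and> lam k = \<mu>}))"

definition psd_form_pd_on :: "('e::real_vector \<Rightarrow> 'e \<Rightarrow> real) \<Rightarrow> 'e set \<Rightarrow> bool" where
  "psd_form_pd_on c V \<longleftrightarrow> bilinear c \<and> symmetric_form c \<and>
     (\<forall>w. 0 \<le> c w w) \<and> (\<forall>v\<in>V. v \<noteq> 0 \<longrightarrow> 0 < c v v)"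

definition discrete_eigensystem ::
    "('e::real_vector \<Rightarrow> 'e \<Rightarrow> real) \<Rightarrow> ('e \<Rightarrow> 'e \<Rightarrow> real) \<Rightarrow> 'e set \<Rightarrow> nat \<Rightarrow>
     (nat \<Rightarrow> real) \<Rightarrow> (nat \<Rightarrow> 'e) \<Rightarrow> bool" where
  "discrete_eigensystem ah bh V n lamt ut \<longleftrightarrow>
     inj_on ut {1..n} \<and> independent (ut ` {1..n}) \<and> span (ut ` {1..n}) = V \<and>
     (\<forall>k\<in>{1..n}. 0 < lamt k) \<and> mono_on {1..n} lamt \<and>
     (\<forall>k\<in>{1..n}. \<forall>l\<in>{1..n}. ah (ut k) (ut l) = (if k = l then lamt k else 0)) \<and>
     (\<forall>k\<in>{1..n}. \<forall>l\<in>{1..n}. bh (ut k) (ut l) = (if k = l then 1 else 0))"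

definition form_norm :: "('e \<Rightarrow> 'e \<Rightarrow> real) \<Rightarrow> 'e \<Rightarrow> real" where
  "form_norm c w = sqrt (c w w)"

(* Well defined for every w when c is a bilinear form that is positive definite on the
   finite-dimensional subspace V. *)
definition form_proj :: "('e \<Rightarrow> 'e \<Rightarrow> real) \<Rightarrow> 'e set \<Rightarrow> 'e \<Rightarrow> 'e" where
  "form_proj c V w = (THE p. p \<in> V \<and> (\<forall>v\<in>V. c p v = c w v))"

definition Q_proj ::
    "('e::real_vector \<Rightarrow> 'e \<Rightarrow> real) \<Rightarrow> nat \<Rightarrow> (nat \<Rightarrow> real) \<Rightarrow> (nat \<Rightarrow> 'e) \<Rightarrow> real set \<Rightarrow> 'e \<Rightarrow> 'e" where
  "Q_proj bh n lamt ut \<Lambda> w = (\<Sum>i | i \<in> {1..n} \<and> lamt i \<in> \<Lambda>. bh w (ut i) *\<^sub>R ut i)"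

(* The maximum of an empty family of these nonnegative quotients is taken to be 0. *)
definition gamma_gap :: "nat \<Rightarrow> (nat \<Rightarrow> real) \<Rightarrow> real set \<Rightarrow> real \<Rightarrow> real" where
  "gamma_gap n lamt \<Lambda> lam =
     (let I = {i \<in> {1..n}. lamt i \<notin> \<Lambda>}
      in if I = {} then 0 else Max ((\<lambda>i. lamt i / \<bar>lamt i - lam\<bar>) ` I))"

definition defect ::
    "('e \<Rightarrow> 'e \<Rightarrow> real) \<Rightarrow> ('e \<Rightarrow> 'e \<Rightarrow> real) \<Rightarrow> real \<Rightarrow> 'e \<Rightarrow> 'e \<Rightarrow> real" where
  "defect ah bh lam w v = ah w v - lam * bh w v"

(* For linear L and a form c that is positive definite on a nonzero finite-dimensional V,
   the supremum is attained, i.e. it is a maximum. *)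
definition dual_norm :: "('e::real_vector \<Rightarrow> 'e \<Rightarrow> real) \<Rightarrow> 'e set \<Rightarrow> ('e \<Rightarrow> real) \<Rightarrow> real" where
  "dual_norm c V L = (SUP v \<in> V - {0}. L v / form_norm c v)"

end

theory Submission
  imports Defs
begin

text \<open>
  Put w = u^e, p = P_h w, and expand in the b_h-orthonormal discrete eigenvectors with c_i = b_h(w, ut_i),
  e_i = b_h(w - p, ut_i) and d_i the value of the defect of w at ut_i. Since
  a_h(w, ut_i) = a_h(p, ut_i) = lamt_i (c_i - e_i), one has
  c_i = lamt_i / (lamt_i - lam) (e_i + d_i / lamt_i) whenever lamt_i differs from lam.
  By Pythagoras the square of the left-hand side is the squared distance of w to V plus the sum of c_i^2
  over lamt_i outside \<Lambda>. Minkowski's inequality splits off the e_i-part, which together with the distance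
  is controlled by w - p, from the d_i-part, which is controlled by testing the dual norm with the sum of
  (d_i / lamt_i) ut_i.
\<close>

section \<open>Bilinear forms and the discrete eigenbasis\<close>

locale discrete_eigenproblem =
  fixes ah bh :: "'e::real_vector \<Rightarrow> 'e \<Rightarrow> real" and V :: "'e set" and n :: nat
    and lamt :: "nat \<Rightarrow> real" and ut :: "nat \<Rightarrow> 'e"
  assumes ah: "psd_form_pd_on ah V"
    and bh: "psd_form_pd_on bh V"
    and eigensys: "discrete_eigensystem ah bh V n lamt ut"
begin

lemma ah_bilinear: "bilinear ah" and bh_bilinear: "bilinear bh"
  using ah bh by (auto simp: psd_form_pd_on_def)

lemma linear_ah: "linear (ah x)" "linear (\<lambda>x. ah x y)"
  and linear_bh: "linear (bh x)" "linear (\<lambda>x. bh x y)"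
  using ah_bilinear bh_bilinear by (auto simp: bilinear_def)

lemma bh_commute: "bh x y = bh y x"
  using bh by (auto simp: psd_form_pd_on_def symmetric_form_def)

lemma bh_nonneg: "0 \<le> bh x x"
  using bh by (auto simp: psd_form_pd_on_def)

lemma ut_orthogonal:
  assumes "i \<in> {1..n}" "l \<in> {1..n}"
  shows "ah (ut i) (ut l) = (if i = l then lamt i else 0)"
    and "bh (ut i) (ut l) = (if i = l then 1 else 0)"
  using eigensys assms by (auto simp: discrete_eigensystem_def)

lemma lamt_pos: "i \<in> {1..n} \<Longrightarrow> 0 < lamt i"
  using eigensys by (auto simp: discrete_eigensystem_def)

lemma lamt_1_le:
  assumes "i \<in> {1..n}"
  shows "lamt 1 \<le> lamt i"
proof -
  have "mono_on {1..n} lamt"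
    using eigensys by (simp add: discrete_eigensystem_def)
  then show ?thesis
    using assms by (auto intro: mono_onD)
qed

lemma span_ut: "span (ut ` {1..n}) = V"
  using eigensys by (auto simp: discrete_eigensystem_def)

lemma ut_in_V: "i \<in> {1..n} \<Longrightarrow> ut i \<in> V"
  unfolding span_ut[symmetric] by (intro span_base imageI)

section \<open>Expansions in the discrete eigenbasis\<close>

lemma sum_ut_in_V: "I \<subseteq> {1..n} \<Longrightarrow> (\<Sum>i\<in>I. c i *\<^sub>R ut i) \<in> V"
  unfolding span_ut[symmetric] by (intro span_sum span_scale span_base) auto

lemma
  assumes "I \<subseteq> {1..n}" "l \<in> {1..n}"
  shows ah_sum_ut: "ah (\<Sum>i\<in>I. c i *\<^sub>R ut i) (ut l) = (if l \<in> I then c l * lamt l else 0)"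
    and bh_sum_ut: "bh (\<Sum>i\<in>I. c i *\<^sub>R ut i) (ut l) = (if l \<in> I then c l else 0)"
proof -
  have fin: "finite I"
    using assms finite_subset by blast
  have "ah (\<Sum>i\<in>I. c i *\<^sub>R ut i) (ut l) = (\<Sum>i\<in>I. c i * ah (ut i) (ut l))"
    by (simp add: linear_sum[OF linear_ah(2)] linear_cmul[OF linear_ah(2)])
  also have "\<dots> = (\<Sum>i\<in>I. if i = l then c l * lamt l else 0)"
    using assms by (intro sum.cong) (auto simp: ut_orthogonal)
  finally show "ah (\<Sum>i\<in>I. c i *\<^sub>R ut i) (ut l) = (if l \<in> I then c l * lamt l else 0)"
    using fin by simp
  have "bh (\<Sum>i\<in>I. c i *\<^sub>R ut i) (ut l) = (\<Sum>i\<in>I. c i * bh (ut i) (ut l))"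
    by (simp add: linear_sum[OF linear_bh(2)] linear_cmul[OF linear_bh(2)])
  also have "\<dots> = (\<Sum>i\<in>I. if i = l then c l else 0)"
    using assms by (intro sum.cong) (auto simp: ut_orthogonal)
  finally show "bh (\<Sum>i\<in>I. c i *\<^sub>R ut i) (ut l) = (if l \<in> I then c l else 0)"
    using fin by simp
qed

lemma ut_expansion:
  assumes "v \<in> V"
  shows "v = (\<Sum>i\<in>{1..n}. bh v (ut i) *\<^sub>R ut i)"
proof -
  \<comment> \<open>Injectivity turns a combination over the image set into one over indices;
    pairing with \<open>ut i\<close> then identifies the coefficients.\<close>
  have "inj_on ut {1..n}"
    using eigensys by (auto simp: discrete_eigensystem_def)
  moreover obtain c where "v = (\<Sum>x\<in>ut ` {1..n}. c x *\<^sub>R x)"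
    using assms unfolding span_ut[symmetric] by (auto simp: span_finite)
  ultimately have v: "v = (\<Sum>i\<in>{1..n}. c (ut i) *\<^sub>R ut i)"
    by (simp add: sum.reindex)
  have "bh v (ut i) = c (ut i)" if "i \<in> {1..n}" for i
    unfolding v using that by (subst bh_sum_ut) auto
  then show ?thesis
    using v by simp
qed

lemma ah_sum_ut_self:
  assumes "I \<subseteq> {1..n}"
  shows "ah (\<Sum>i\<in>I. c i *\<^sub>R ut i) (\<Sum>i\<in>I. c i *\<^sub>R ut i) = (\<Sum>i\<in>I. (c i)\<^sup>2 * lamt i)"
proof -
  have "ah (\<Sum>i\<in>I. c i *\<^sub>R ut i) (\<Sum>l\<in>I. c l *\<^sub>R ut l)
      = (\<Sum>l\<in>I. c l * ah (\<Sum>i\<in>I. c i *\<^sub>R ut i) (ut l))"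
    by (simp add: linear_sum[OF linear_ah(1)] linear_cmul[OF linear_ah(1)])
  also have "\<dots> = (\<Sum>l\<in>I. c l * (c l * lamt l))"
    by (intro sum.cong) (simp_all add: ah_sum_ut[OF assms subsetD[OF assms]])
  finally show ?thesis
    by (simp add: power2_eq_square mult_ac)
qed

text \<open>Expanding the square and completing it in each \<open>c i\<close> separates the error of
  the best approximation from the error of the coefficients. The coefficients are left free because
  both projections are treated this way: for \<open>Q_proj\<close> the last sum vanishes, for
  \<open>form_proj\<close> it does not.\<close>

lemma bh_diff_sum_ut_self:
  assumes "I \<subseteq> {1..n}"
  shows "bh (w - (\<Sum>i\<in>I. c i *\<^sub>R ut i)) (w - (\<Sum>i\<in>I. c i *\<^sub>R ut i))
    = bh w w - (\<Sum>i\<in>I. (bh w (ut i))\<^sup>2) + (\<Sum>i\<in>I. (bh w (ut i) - c i)\<^sup>2)"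
proof -
  let ?s = "\<Sum>i\<in>I. c i *\<^sub>R ut i"
  have bs: "bh x ?s = (\<Sum>i\<in>I. c i * bh x (ut i))" for x
    by (simp add: linear_sum[OF linear_bh(1)] linear_cmul[OF linear_bh(1)])
  have "bh ?s ?s = (\<Sum>i\<in>I. c i * c i)"
    unfolding bs by (intro sum.cong) (simp_all add: bh_sum_ut[OF assms subsetD[OF assms]])
  moreover have "bh (w - ?s) (w - ?s) = bh w w - 2 * bh w ?s + bh ?s ?s"
    by (simp add: linear_diff[OF linear_bh(1)] linear_diff[OF linear_bh(2)] bh_commute[of ?s w])
  ultimately have "bh (w - ?s) (w - ?s)
      = bh w w - 2 * (\<Sum>i\<in>I. c i * bh w (ut i)) + (\<Sum>i\<in>I. c i * c i)"
    by (simp only: bs)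
  then show ?thesis
    by (simp add: power2_eq_square left_diff_distrib right_diff_distrib sum_subtractf
        sum.distrib sum_distrib_left mult_ac)
qed

lemma bessel:
  assumes "I \<subseteq> {1..n}"
  shows "(\<Sum>i\<in>I. (bh w (ut i))\<^sup>2) \<le> bh w w"
  using bh_nonneg[of "w - (\<Sum>i\<in>I. bh w (ut i) *\<^sub>R ut i)"] bh_diff_sum_ut_self[OF assms]
  by simp

section \<open>The \<open>ah\<close>-orthogonal projection onto \<open>V\<close>\<close>

lemma form_proj_ah: "form_proj ah V w = (\<Sum>i\<in>{1..n}. (ah w (ut i) / lamt i) *\<^sub>R ut i)"
proof -
  \<comment> \<open>Pairing an element of \<open>V\<close> with \<open>ut i\<close> under
    \<open>ah\<close> gives \<open>lamt i\<close> times its coefficient, which dictates the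
    coefficients of \<open>p\<close>.\<close>
  define p where "p = (\<Sum>i\<in>{1..n}. (ah w (ut i) / lamt i) *\<^sub>R ut i)"
  have "p \<in> V"
    unfolding p_def by (rule sum_ut_in_V) simp
  have p_ut: "ah p (ut i) = ah w (ut i)" if "i \<in> {1..n}" for i
    using that lamt_pos[OF that] unfolding p_def by (subst ah_sum_ut) auto
  have p: "ah p v = ah w v" if "v \<in> V" for v
  proof -
    have "ah x v = (\<Sum>i\<in>{1..n}. bh v (ut i) * ah x (ut i))" for x
      by (subst ut_expansion[OF that])
        (simp add: linear_sum[OF linear_ah(1)] linear_cmul[OF linear_ah(1)])
    then show ?thesis
      using p_ut by simp
  qed
  \<comment> \<open>Two candidates differ by an element of \<open>V\<close> of zero
    \<open>ah\<close>-energy, which is 0 by definiteness on \<open>V\<close>; this resolves the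
    \<open>THE\<close>.\<close>
  have unique: "q = p" if q: "q \<in> V" "\<forall>v\<in>V. ah q v = ah w v" for q
  proof -
    have "q - p \<in> V"
      using q(1) \<open>p \<in> V\<close> span_diff unfolding span_ut[symmetric] by blast
    moreover from this have "ah (q - p) (q - p) = 0"
      using q(2) p by (simp add: linear_diff[OF linear_ah(2)])
    ultimately show ?thesis
      using ah by (fastforce simp: psd_form_pd_on_def)
  qed
  show ?thesis
    unfolding form_proj_def p_def[symmetric]
  proof (rule the_equality)
    show "p \<in> V \<and> (\<forall>v\<in>V. ah p v = ah w v)"
      using \<open>p \<in> V\<close> p by blast
  qed (use unique in blast)
qed

lemma bh_form_proj_ut:
  assumes "i \<in> {1..n}"
  shows "bh (form_proj ah V w) (ut i) = ah w (ut i) / lamt i"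
  unfolding form_proj_ah using assms by (subst bh_sum_ut) auto

section \<open>The dual norm in terms of the eigenbasis\<close>

lemma linear_functional_le_form_norm:
  assumes "linear L" "v \<in> V"
  shows "L v \<le> L2_set (\<lambda>i. L (ut i) / sqrt (lamt i)) {1..n} * form_norm ah v"
proof -
  let ?b = "\<lambda>i. bh v (ut i)"
  have v: "v = (\<Sum>i\<in>{1..n}. ?b i *\<^sub>R ut i)"
    using assms(2) by (rule ut_expansion)
  have "ah v v = (\<Sum>i\<in>{1..n}. (?b i)\<^sup>2 * lamt i)"
    using ah_sum_ut_self[of "{1..n}" ?b] v by simp
  also have "\<dots> = (\<Sum>i\<in>{1..n}. (sqrt (lamt i) * ?b i)\<^sup>2)"
    by (intro sum.cong) (auto simp: power_mult_distrib less_imp_le[OF lamt_pos])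
  finally have norm_v: "form_norm ah v = L2_set (\<lambda>i. sqrt (lamt i) * ?b i) {1..n}"
    by (simp add: form_norm_def L2_set_def)
  have "L v = (\<Sum>i\<in>{1..n}. ?b i * L (ut i))"
    by (subst v) (simp add: linear_sum[OF assms(1)] linear_cmul[OF assms(1)])
  \<comment> \<open>The weights \<open>sqrt (lamt i)\<close> are inserted so that Cauchy-Schwarz
    produces exactly the energy norm of \<open>v\<close> in the second factor.\<close>
  also have "\<dots> = (\<Sum>i\<in>{1..n}. (L (ut i) / sqrt (lamt i)) * (sqrt (lamt i) * ?b i))"
    using lamt_pos by (intro sum.cong) (auto simp: less_le)
  also have "\<dots> \<le> (\<Sum>i\<in>{1..n}. \<bar>L (ut i) / sqrt (lamt i)\<bar> * \<bar>sqrt (lamt i) * ?b i\<bar>)"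
    by (intro sum_mono) (metis abs_ge_self abs_mult)
  also have "\<dots> \<le> L2_set (\<lambda>i. L (ut i) / sqrt (lamt i)) {1..n} * form_norm ah v"
    unfolding norm_v by (rule L2_set_mult_ineq)
  finally show ?thesis .
qed

lemma form_norm_ah_pos: "v \<in> V \<Longrightarrow> v \<noteq> 0 \<Longrightarrow> 0 < form_norm ah v"
  using ah by (auto simp: psd_form_pd_on_def form_norm_def)

lemma le_dual_norm:
  assumes "linear L" "v \<in> V" "v \<noteq> 0"
  shows "L v / form_norm ah v \<le> dual_norm ah V L"
  unfolding dual_norm_def
proof (rule cSUP_upper)
  show "v \<in> V - {0}"
    using assms by simp
  \<comment> \<open>The real \<open>SUP\<close> is an upper bound only for a family bounded above;
    the Cauchy-Schwarz estimate supplies the bound.\<close>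
  show "bdd_above ((\<lambda>v. L v / form_norm ah v) ` (V - {0}))"
    using linear_functional_le_form_norm[OF assms(1)] form_norm_ah_pos
    by (intro bdd_aboveI2) (auto simp: pos_divide_le_eq)
qed

text \<open>On the span of the \<open>ut i\<close> with \<open>i \<in> I\<close>, the functional
  \<open>L\<close> has the \<open>ah\<close>-Riesz representative \<open>v\<close> defined below.
  Since \<open>L v = ah v v = S\<close>, the quotient at \<open>v\<close> equals
  \<open>sqrt S\<close>, the left-hand side. Nonemptiness of \<open>I\<close> guarantees that a
  nonzero test vector exists.\<close>

lemma L2_set_le_dual_norm:
  assumes "linear L" "I \<subseteq> {1..n}" "I \<noteq> {}"
  shows "L2_set (\<lambda>i. L (ut i) / sqrt (lamt i)) I \<le> dual_norm ah V L"
proof -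
  define S where "S = (\<Sum>i\<in>I. (L (ut i) / sqrt (lamt i))\<^sup>2)"
  define v where "v = (\<Sum>i\<in>I. (L (ut i) / lamt i) *\<^sub>R ut i)"
  have S: "S = (\<Sum>i\<in>I. (L (ut i))\<^sup>2 / lamt i)"
    unfolding S_def using assms(2) lamt_pos
    by (intro sum.cong) (auto simp: power_divide less_imp_le subsetD)
  have fin: "finite I"
    using assms(2) finite_subset by blast
  show ?thesis
  proof (cases "S = 0")
    \<comment> \<open>Here \<open>v\<close> is 0 and cannot be a test vector. Any
      \<open>ut i\<close> with \<open>i \<in> I\<close> serves instead: \<open>L\<close> vanishes on
      it, so the dual norm is at least 0.\<close>
    case True
    obtain i where i: "i \<in> I"
      using assms(3) by blast
    then have i': "i \<in> {1..n}"
      using assms(2) by blast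
    have "(L (ut i) / sqrt (lamt i))\<^sup>2 = 0"
      using True i fin unfolding S_def by (subst (asm) sum_nonneg_eq_0_iff) auto
    then have "L (ut i) = 0"
      using lamt_pos[OF i'] by auto
    moreover have "ut i \<noteq> 0"
      using ut_orthogonal(2)[OF i' i'] linear_0[OF linear_bh(2)] by force
    ultimately have "0 \<le> dual_norm ah V L"
      using le_dual_norm[OF assms(1) ut_in_V[OF i']] by simp
    then show ?thesis
      using True by (simp add: L2_set_def S_def)
  next
    case False
    moreover have "0 \<le> S"
      unfolding S_def by (intro sum_nonneg) auto
    ultimately have "0 < S"
      by simp
    have "L v = S"
      unfolding v_def S
      by (simp add: linear_sum[OF assms(1)] linear_cmul[OF assms(1)] power2_eq_square)
    moreover have "ah v v = S"
      unfolding v_def S ah_sum_ut_self[OF assms(2)] using assms(2) lamt_pos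
      by (intro sum.cong) (force simp: field_simps power2_eq_square)+
    moreover have "v \<noteq> 0"
      using \<open>L v = S\<close> \<open>0 < S\<close> linear_0[OF assms(1)] by force
    moreover have "v \<in> V"
      unfolding v_def using assms(2) by (rule sum_ut_in_V)
    ultimately have "S / sqrt S \<le> dual_norm ah V L"
      using le_dual_norm[OF assms(1), of v] by (simp add: form_norm_def)
    then show ?thesis
      using \<open>0 < S\<close> by (simp add: L2_set_def S_def[symmetric] real_div_sqrt)
  qed
qed

section \<open>Defect identity and spectral gap\<close>

lemma linear_defect: "linear (defect ah bh \<mu> w)"
  by (rule linearI) (simp_all add: defect_def algebra_simps linear_add[OF linear_ah(1)]
    linear_add[OF linear_bh(1)] linear_cmul[OF linear_ah(1)] linear_cmul[OF linear_bh(1)])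

text \<open>The projection preserves the \<open>ah\<close>-pairing with \<open>ut i\<close>, so
  \<open>ah w (ut i)\<close> is \<open>lamt i\<close> times the coefficient of the projection;
  substituting this into the defect gives the identity.\<close>

lemma bh_ut_eq_defect:
  assumes "i \<in> {1..n}"
  shows "(lamt i - \<mu>) * bh w (ut i)
    = lamt i * bh (w - form_proj ah V w) (ut i) + defect ah bh \<mu> w (ut i)"
  using lamt_pos[OF assms] bh_form_proj_ut[OF assms]
  by (simp add: defect_def linear_diff[OF linear_bh(2)] algebra_simps)

lemma
  assumes "i \<in> {1..n}" "lamt i \<notin> \<Lambda>"
  shows le_gamma_gap: "lamt i / \<bar>lamt i - \<mu>\<bar> \<le> gamma_gap n lamt \<Lambda> \<mu>"
    and gamma_gap_nonneg: "0 \<le> gamma_gap n lamt \<Lambda> \<mu>"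
proof -
  show "lamt i / \<bar>lamt i - \<mu>\<bar> \<le> gamma_gap n lamt \<Lambda> \<mu>"
    using assms unfolding gamma_gap_def Let_def by (subst if_not_P) (auto intro!: Max_ge)
  moreover have "0 \<le> lamt i / \<bar>lamt i - \<mu>\<bar>"
    using lamt_pos[OF assms(1)] by simp
  ultimately show "0 \<le> gamma_gap n lamt \<Lambda> \<mu>"
    by linarith
qed

section \<open>The estimate for an element \<open>w\<close> and a point \<open>\<mu>\<close> of
  \<open>\<Lambda>\<close>\<close>

theorem form_norm_diff_Q_proj_le:
  assumes "\<mu> \<in> \<Lambda>"
  shows "form_norm bh (w - Q_proj bh n lamt ut \<Lambda> w)
     \<le> max 1 (gamma_gap n lamt \<Lambda> \<mu>) * form_norm bh (w - form_proj ah V w)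
       + gamma_gap n lamt \<Lambda> \<mu> * lamt 1 powr (- 1 / 2) * dual_norm ah V (defect ah bh \<mu> w)"
proof -
  define p where "p = form_proj ah V w"
  define \<gamma> where "\<gamma> = gamma_gap n lamt \<Lambda> \<mu>"
  define I where "I = {i \<in> {1..n}. lamt i \<notin> \<Lambda>}"
  define J where "J = {i \<in> {1..n}. lamt i \<in> \<Lambda>}"
  \<comment> \<open>\<open>M\<close> has to dominate both the factor 1 in front of \<open>A\<close>
    and the factors \<open>\<bar>g i\<bar>\<close> in front of the \<open>e i\<close>.\<close>
  define M where "M = max 1 \<gamma>"
  define c where "c i = bh w (ut i)" for i
  define e where "e i = bh (w - p) (ut i)" for i
  define d where "d i = defect ah bh \<mu> w (ut i)" for i
  \<comment> \<open>The signed amplification factor; for \<open>i \<in> I\<close> its absolute value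
    is one of the quotients whose maximum is \<open>\<gamma>\<close>.\<close>
  define g where "g i = lamt i / (lamt i - \<mu>)" for i
  \<comment> \<open>The squared \<open>bh\<close>-distance from \<open>w\<close> to
    \<open>V\<close>, common to both projection errors.\<close>
  define A where "A = bh w w - (\<Sum>i\<in>{1..n}. (c i)\<^sup>2)"
  have "A \<ge> 0"
    unfolding A_def c_def using bessel[of "{1..n}" w] by simp
  have "M \<ge> 1"
    by (simp add: M_def)
  have split: "(\<Sum>i\<in>{1..n}. f i) = (\<Sum>i\<in>I. f i) + (\<Sum>i\<in>J. f i)" for f :: "nat \<Rightarrow> real"
    unfolding I_def J_def by (subst sum.union_disjoint[symmetric]) (auto intro!: sum.cong)
  have lhs: "bh (w - Q_proj bh n lamt ut \<Lambda> w) (w - Q_proj bh n lamt ut \<Lambda> w) = A + (\<Sum>i\<in>I. (c i)\<^sup>2)"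
  proof -
    have "J \<subseteq> {1..n}"
      by (auto simp: J_def)
    \<comment> \<open>The coefficients of \<open>Q_proj\<close> are exact, so only the squares over
      \<open>J\<close> are subtracted; relative to \<open>A\<close> those over \<open>I\<close>
      remain.\<close>
    from bh_diff_sum_ut_self[OF this, of w c] show ?thesis
      unfolding Q_proj_def A_def split J_def[symmetric] by (simp add: c_def)
  qed
  have p: "bh (w - p) (w - p) = A + (\<Sum>i\<in>{1..n}. (e i)\<^sup>2)"
  proof -
    have "e i = c i - ah w (ut i) / lamt i" if "i \<in> {1..n}" for i
      by (simp add: e_def c_def p_def linear_diff[OF linear_bh(2)] bh_form_proj_ut[OF that])
    then show ?thesis
      using bh_diff_sum_ut_self[of "{1..n}" w "\<lambda>i. ah w (ut i) / lamt i"]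
      by (simp add: p_def form_proj_ah A_def c_def)
  qed
  have I: "i \<in> {1..n}" "lamt i \<notin> \<Lambda>" "lamt i \<noteq> \<mu>" "0 < lamt i" "\<bar>g i\<bar> \<le> \<gamma>"
    if "i \<in> I" for i
  proof -
    show i: "i \<in> {1..n}" "lamt i \<notin> \<Lambda>"
      using that by (auto simp: I_def)
    \<comment> \<open>\<open>\<mu>\<close> lies in \<open>\<Lambda>\<close> and
      \<open>lamt i\<close> does not, so the denominators are nonzero.\<close>
    then show "lamt i \<noteq> \<mu>" "0 < lamt i"
      using assms lamt_pos by auto
    then show "\<bar>g i\<bar> \<le> \<gamma>"
      using le_gamma_gap[OF i, of \<mu>] by (simp add: g_def \<gamma>_def)
  qed
  have c_eq: "c i = g i * e i + g i * d i / lamt i" if "i \<in> I" for i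
  proof -
    have "(lamt i - \<mu>) * c i = lamt i * e i + d i"
      using bh_ut_eq_defect[OF I(1)[OF that], of \<mu> w] by (simp add: c_def e_def d_def p_def)
    then have "c i = (lamt i * e i + d i) / (lamt i - \<mu>)"
      using I(3)[OF that] by (metis eq_iff_diff_eq_0 nonzero_mult_div_cancel_left)
    then show ?thesis
      using I(4)[OF that] by (simp add: g_def add_divide_distrib)
  qed
  have part_e: "sqrt (A + (\<Sum>i\<in>I. (g i * e i)\<^sup>2)) \<le> M * form_norm bh (w - p)"
  proof -
    have "(\<Sum>i\<in>I. (g i * e i)\<^sup>2) \<le> (\<Sum>i\<in>I. M\<^sup>2 * (e i)\<^sup>2)"
    proof (rule sum_mono)
      fix i assume "i \<in> I"
      then have "\<bar>g i\<bar> \<le> \<bar>M\<bar>"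
        using I(5) by (force simp: M_def)
      then show "(g i * e i)\<^sup>2 \<le> M\<^sup>2 * (e i)\<^sup>2"
        by (simp add: power_mult_distrib mult_right_mono abs_le_square_iff)
    qed
    also have "\<dots> \<le> M\<^sup>2 * (\<Sum>i\<in>{1..n}. (e i)\<^sup>2)"
      unfolding sum_distrib_left[symmetric] I_def by (intro mult_left_mono sum_mono2) auto
    finally have "A + (\<Sum>i\<in>I. (g i * e i)\<^sup>2) \<le> M\<^sup>2 * A + M\<^sup>2 * (\<Sum>i\<in>{1..n}. (e i)\<^sup>2)"
      using mult_right_mono[of 1 "M\<^sup>2" A] \<open>A \<ge> 0\<close> \<open>M \<ge> 1\<close> by simp
    then have "A + (\<Sum>i\<in>I. (g i * e i)\<^sup>2) \<le> M\<^sup>2 * bh (w - p) (w - p)"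
      unfolding p by (simp add: distrib_left)
    then have "sqrt (A + (\<Sum>i\<in>I. (g i * e i)\<^sup>2)) \<le> sqrt (M\<^sup>2 * bh (w - p) (w - p))"
      by (rule real_sqrt_le_mono)
    then show ?thesis
      using \<open>M \<ge> 1\<close> by (simp add: form_norm_def real_sqrt_mult)
  qed
  have part_d: "L2_set (\<lambda>i. g i * d i / lamt i) I
      \<le> \<gamma> * lamt 1 powr (- 1 / 2) * dual_norm ah V (defect ah bh \<mu> w)"
  proof (cases "I = {}")
    case True
    \<comment> \<open>The default value 0 of \<open>gamma_gap\<close> makes both sides vanish,
      whatever the values of \<open>lamt 1\<close> and \<open>dual_norm\<close>; this covers
      \<open>n = 0\<close>.\<close>
    then have "\<gamma> = 0"
      unfolding \<gamma>_def gamma_gap_def I_def by simp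
    then show ?thesis
      using True by simp
  next
    case False
    then obtain l where l: "l \<in> I"
      by blast
    \<comment> \<open>An element of \<open>I\<close> forces \<open>n\<close> to be at least 1, so
      index 1 is admissible.\<close>
    have "0 < lamt 1"
      using I(1)[OF l] by (intro lamt_pos) auto
    have "0 \<le> \<gamma>"
      unfolding \<gamma>_def using I(1,2)[OF l] by (rule gamma_gap_nonneg)
    define C where "C = \<gamma> * lamt 1 powr (- 1 / 2)"
    have "0 \<le> C"
      unfolding C_def using \<open>0 \<le> \<gamma>\<close> by simp
    have "\<bar>g i * d i / lamt i\<bar> \<le> C * \<bar>d i / sqrt (lamt i)\<bar>" if "i \<in> I" for i
    proof -
      \<comment> \<open>The factor \<open>1 / lamt i\<close> is split into two square roots: one is
        bounded through \<open>lamt 1\<close>, the other is the weight required by the dual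
        norm.\<close>
      have "\<bar>g i * d i / lamt i\<bar> = (\<bar>g i\<bar> * (1 / sqrt (lamt i))) * \<bar>d i / sqrt (lamt i)\<bar>"
        using I(4)[OF that] by (simp add: abs_mult)
      also have "\<dots> \<le> (\<gamma> * (1 / sqrt (lamt 1))) * \<bar>d i / sqrt (lamt i)\<bar>"
        using I(4,5)[OF that] \<open>0 \<le> \<gamma>\<close> \<open>0 < lamt 1\<close> lamt_1_le[OF I(1)[OF that]]
        by (intro mult_right_mono mult_mono frac_le) auto
      also have "1 / sqrt (lamt 1) = lamt 1 powr (- 1 / 2)"
        using \<open>0 < lamt 1\<close> by (simp add: powr_minus_divide powr_half_sqrt)
      finally show ?thesis
        by (simp add: C_def)
    qed
    then have "L2_set (\<lambda>i. \<bar>g i * d i / lamt i\<bar>) I \<le> L2_set (\<lambda>i. C * \<bar>d i / sqrt (lamt i)\<bar>) I"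
      by (intro L2_set_mono) auto
    also have "\<dots> = C * L2_set (\<lambda>i. \<bar>d i / sqrt (lamt i)\<bar>) I"
      using \<open>0 \<le> C\<close> by (simp add: L2_set_right_distrib)
    also have "L2_set (\<lambda>i. \<bar>d i / sqrt (lamt i)\<bar>) I = L2_set (\<lambda>i. d i / sqrt (lamt i)) I"
      by (simp only: L2_set_def power2_abs)
    also have "C * \<dots> \<le> C * dual_norm ah V (defect ah bh \<mu> w)"
      unfolding d_def using I(1) False \<open>0 \<le> C\<close>
      by (intro mult_left_mono L2_set_le_dual_norm linear_defect subsetI)
    finally show ?thesis
      by (simp only: C_def L2_set_def power2_abs)
  qed
  have "form_norm bh (w - Q_proj bh n lamt ut \<Lambda> w) = sqrt ((sqrt A)\<^sup>2 + (L2_set c I)\<^sup>2)"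
    using \<open>A \<ge> 0\<close> unfolding form_norm_def lhs by (simp add: L2_set_def sum_nonneg)
  \<comment> \<open>Minkowski over \<open>I\<close> comes first. The planar triangle inequality
    follows, with the distance \<open>sqrt A\<close> assigned wholly to the \<open>e\<close>-part
    and 0 to the \<open>d\<close>-part.\<close>
  also have "\<dots> \<le> sqrt ((sqrt A + 0)\<^sup>2
      + (L2_set (\<lambda>i. g i * e i) I + L2_set (\<lambda>i. g i * d i / lamt i) I)\<^sup>2)"
  proof -
    have "L2_set c I = L2_set (\<lambda>i. g i * e i + g i * d i / lamt i) I"
      using c_eq by (intro L2_set_cong) auto
    also have "\<dots> \<le> L2_set (\<lambda>i. g i * e i) I + L2_set (\<lambda>i. g i * d i / lamt i) I"
      by (rule L2_set_triangle_ineq)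
    finally show ?thesis
      using \<open>A \<ge> 0\<close> by (intro real_sqrt_le_mono add_mono power_mono) auto
  qed
  also have "\<dots> \<le> sqrt ((sqrt A)\<^sup>2 + (L2_set (\<lambda>i. g i * e i) I)\<^sup>2)
      + sqrt (0\<^sup>2 + (L2_set (\<lambda>i. g i * d i / lamt i) I)\<^sup>2)"
    by (rule real_sqrt_sum_squares_triangle_ineq)
  also have "\<dots> = sqrt (A + (\<Sum>i\<in>I. (g i * e i)\<^sup>2)) + L2_set (\<lambda>i. g i * d i / lamt i) I"
    using \<open>A \<ge> 0\<close> by (simp add: L2_set_def sum_nonneg)
  finally show ?thesis
    using part_e part_d unfolding M_def \<gamma>_def p_def by linarith
qed

end

theorem theorem6p2:
  fixes j :: "'h::{real_inner,complete_space} \<Rightarrow> 'g::{real_inner,complete_space}"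
    and a :: "'h \<Rightarrow> 'h \<Rightarrow> real" and b :: "'h \<Rightarrow> 'h \<Rightarrow> real"
    and lam :: "nat \<Rightarrow> real" and u :: "nat \<Rightarrow> 'h"
    and ext :: "'h \<Rightarrow> 'e::real_vector"
    and V :: "'e set" and n :: nat
    and ah bh :: "'e \<Rightarrow> 'e \<Rightarrow> real"
    and lamt :: "nat \<Rightarrow> real" and ut :: "nat \<Rightarrow> 'e"
    and k kmax :: nat and \<Lambda> :: "real set"
  assumes "\<not> finite_dim (UNIV :: 'h set)" and "\<not> finite_dim (UNIV :: 'g set)"
    and "compact_embedding j"
    and "bounded_bilinear a" and "symmetric_form a" and "elliptic_form a"
    and b_def: "b = (\<lambda>v w. inner (j v) (j w))"
    and "eigensystem a b lam u"
    and "linear ext" and "inj ext"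
    and "subspace V" and "finite_dim V" and "n = dim V"
    and "psd_form_pd_on ah V" and "psd_form_pd_on bh V"
    and "discrete_eigensystem ah bh V n lamt ut"
    and "1 \<le> k" and "k \<le> kmax"
    and "lam k \<in> interior \<Lambda>"
  shows "form_norm bh (ext (u k) - Q_proj bh n lamt ut \<Lambda> (ext (u k)))
     \<le> max 1 (gamma_gap n lamt \<Lambda> (lam k))
           * form_norm bh (ext (u k) - form_proj ah V (ext (u k)))
       + gamma_gap n lamt \<Lambda> (lam k) * lamt 1 powr (- 1 / 2)
           * dual_norm ah V (defect ah bh (lam k) (ext (u k)))"
proof -
  \<comment> \<open>The estimate is applied with \<open>w = ext (u k)\<close> and
    \<open>\<mu> = lam k\<close>.\<close>
  interpret discrete_eigenproblem ah bh V n lamt ut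
    by (rule discrete_eigenproblem.intro) (rule assms)+
  have "lam k \<in> \<Lambda>"
    using interior_subset assms(19) by (rule subsetD)
  then show ?thesis
    by (rule form_norm_diff_Q_proj_le)
qed

end
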